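(* Define $!_{a}:\mathbb{N}\to\mathbb{Z}^+$ by $0!_{a}=1$, $1!_{a}=1$ and, inductively, by setting $(n+1)!_{a}=n!_{a}$ whenever $n=3m-1$ for some integer $m\ge1$, and $$n!_{a}=\begin{cases} n!\,(n+1)!\,\prod_{j=1}^{n-1}\big((n-j)!_{a}\big)^2, & \text{if } n=3m-1 \text{ for some integer } m\ge1,\\[4pt] n!\,\prod_{j=1}^{n-1}\big((n-j)!_{a}\big)^2, & \text{if } n=3m+1 \text{ for some integer } m\ge1,\end{cases}$$ where $n!$ and $(n+1)!$ without subscript denote ordinary factorials. Then $!_{a}$ is an exceptional abstract factorial.
   Context: $\mathbb{N}=\{0,1,2,\dots\}$ and $\mathbb{Z}^+=\{1,2,3,\dots\}$. An abstract factorial is a function $!_{a}:\mathbb{N}\to\mathbb{Z}^+$, $n\mapsto n!_{a}$, such that: (1) $0!_{a}=1$; (2) for all integers $0\le k\le n$, the generalized binomial coefficient $\binom{n}{k}_{a}:=\frac{n!_{a}}{k!_{a}\,(n-k)!_{a}}$ is a positive integer; (3) for every positive integer $n$, the ordinary factorial $n!$ divides $n!_{a}$. An abstract factorial is called exceptional if $\limsup_{k\to\infty}\frac{1}{r_k}=1$, where $r_k=\frac{(k+1)!_{a}}{k!_{a}}$. *)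

theory Defs
  imports Complex_Main "HOL-Library.Extended_Real"
begin

definition gen_binomial :: "(nat \<Rightarrow> nat) \<Rightarrow> nat \<Rightarrow> nat \<Rightarrow> real" where
  "gen_binomial f n k = real (f n) / (real (f k) * real (f (n - k)))"

definition abstract_factorial :: "(nat \<Rightarrow> nat) \<Rightarrow> bool" where
  "abstract_factorial f \<longleftrightarrow>
     (\<forall>n. f n > 0) \<and>
     f 0 = 1 \<and>
     (\<forall>n k. k \<le> n \<longrightarrow> gen_binomial f n k \<in> \<int> \<and> gen_binomial f n k > 0) \<and>
     (\<forall>n\<ge>1. fact n dvd f n)"

definition factorial_ratio :: "(nat \<Rightarrow> nat) \<Rightarrow> nat \<Rightarrow> real" where
  "factorial_ratio f k = real (f (k + 1)) / real (f k)"

text \<open>The upper limit is taken in the extended reals, where it always exists.\<close>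

definition exceptional :: "(nat \<Rightarrow> nat) \<Rightarrow> bool" where
  "exceptional f \<longleftrightarrow>
     abstract_factorial f \<and> limsup (\<lambda>k. ereal (1 / factorial_ratio f k)) = 1"

text \<open>The last branch is reached only for \<open>n = 3 * m\<close> with \<open>m \<ge> 1\<close>, that is, when
  the predecessor of \<open>n\<close> has the form \<open>3 * m - 1\<close>; see \<open>afact_eqs\<close> below.\<close>

function afact :: "nat \<Rightarrow> nat" where
  "afact n =
     (if n \<le> 1 then 1
      else if \<exists>m\<ge>1. n = 3 * m - 1 then fact n * fact (n + 1) * (\<Prod>j = 1..n - 1. (afact (n - j))\<^sup>2)
      else if \<exists>m\<ge>1. n = 3 * m + 1 then fact n * (\<Prod>j = 1..n - 1. (afact (n - j))\<^sup>2)
      else afact (n - 1))"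
  by pat_completeness auto
termination
  by (relation "measure id") auto

declare afact.simps [simp del]

lemma afact_eqs:
  "afact 0 = 1"
  "afact 1 = 1"
  "\<exists>m\<ge>1. n = 3 * m - 1 \<Longrightarrow> afact (n + 1) = afact n"
  "\<exists>m\<ge>1. n = 3 * m - 1 \<Longrightarrow>
     afact n = fact n * fact (n + 1) * (\<Prod>j = 1..n - 1. (afact (n - j))\<^sup>2)"
  "\<exists>m\<ge>1. n = 3 * m + 1 \<Longrightarrow>
     afact n = fact n * (\<Prod>j = 1..n - 1. (afact (n - j))\<^sup>2)"
proof -
  show "afact 0 = 1" "afact 1 = 1"
    by (simp_all add: afact.simps)
  show "afact (n + 1) = afact n" if n: "\<exists>m\<ge>1. n = 3 * m - 1"
  proof -
    have "\<not> n + 1 \<le> 1" "\<not> (\<exists>m\<ge>1. n + 1 = 3 * m - 1)" "\<not> (\<exists>m\<ge>1. n + 1 = 3 * m + 1)"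
      using n by presburger+
    then show ?thesis
      by (subst afact.simps) (simp only: if_False add_diff_cancel_right')
  qed
  show "afact n = fact n * fact (n + 1) * (\<Prod>j = 1..n - 1. (afact (n - j))\<^sup>2)"
    if n: "\<exists>m\<ge>1. n = 3 * m - 1"
  proof -
    have "\<not> n \<le> 1"
      using n by presburger
    with n show ?thesis
      by (subst afact.simps) (simp only: if_True if_False)
  qed
  show "afact n = fact n * (\<Prod>j = 1..n - 1. (afact (n - j))\<^sup>2)"
    if n: "\<exists>m\<ge>1. n = 3 * m + 1"
  proof -
    have "\<not> n \<le> 1" "\<not> (\<exists>m\<ge>1. n = 3 * m - 1)"
      using n by presburger+
    with n show ?thesis
      by (subst afact.simps) (simp only: if_True if_False)
  qed
qed

end

theory Submission
  imports Defs
begin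

text \<open>
  The square of the product of all earlier values absorbs every product of the factorials of
  \<open>k\<close> and \<open>n - k\<close> with \<open>0 < k < n\<close>. At a multiple \<open>n\<close> of 3 the value is the one at \<open>n - 1\<close>, where
  only the indices up to \<open>n - 2\<close> occur, but the missing case \<open>k = 1\<close> is trivial; the extra
  factor \<open>(n + 1)!\<close> in the case \<open>n = 3 m - 1\<close> is what makes \<open>n!\<close> divide the value at multiples
  of 3. The ratios of consecutive values are thus at least 1, with equality infinitely often.
\<close>

lemma afact_prod_rev: "(\<Prod>j = 1..n - 1. (afact (n - j))\<^sup>2) = (\<Prod>i = 1..n - 1. afact i)\<^sup>2"
proof (cases n)
  case (Suc k)
  then show ?thesis
    by (subst prod.atLeastAtMost_rev) (auto simp: prod_power_distrib intro!: prod.cong)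
qed simp

text \<open>Each of the two copies of the product supplies one of the factors, so
  \<open>a = b\<close> is allowed; this is needed for \<open>k = n - k\<close>.\<close>

lemma mult_dvd_prod_power2:
  fixes f :: "'b \<Rightarrow> 'a :: comm_semiring_1"
  assumes "finite A" "a \<in> A" "b \<in> A"
  shows "f a * f b dvd (prod f A)\<^sup>2"
  using assms by (simp add: power2_eq_square mult_dvd_mono dvd_prodI)

text \<open>Both recursive branches share the last shape, with \<open>c\<close> equal to
  \<open>fact (n + 1)\<close> or 1. The middle shape belongs to the multiples of 3: it is the
  formula for \<open>n - 1\<close>, so its product stops at \<open>n - 2\<close>.\<close>

lemma afact_cases:
  obtains "n \<le> 1" "afact n = 1"
  | "afact n = fact (n - 1) * fact n * (\<Prod>i = 1..n - 2. afact i)\<^sup>2"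
      "afact n = afact (n - 1)"
  | c where "n \<ge> 2" "afact n = fact n * c * (\<Prod>i = 1..n - 1. afact i)\<^sup>2" "c > 0"
proof -
  have "n \<le> 1 \<or> (\<exists>m\<ge>1. n = 3 * m) \<or> (\<exists>m\<ge>1. n = 3 * m - 1) \<or> (\<exists>m\<ge>1. n = 3 * m + 1)"
    by presburger
  then consider "n \<le> 1" | m where "m \<ge> 1" "n = 3 * m" | m where "m \<ge> 1" "n = 3 * m - 1"
    | m where "m \<ge> 1" "n = 3 * m + 1"
    by blast
  then show thesis
  proof cases
    case 1
    then have "n = 0 \<or> n = 1"
      by auto
    then show thesis
      using that(1) afact_eqs(1,2) by auto
  next
    case (2 m)
    then have "\<exists>m\<ge>1. n - 1 = 3 * m - 1" "n - 1 + 1 = n" "n - 1 - 1 = n - 2"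
      by auto
    with that(2) afact_eqs(3,4)[of "n - 1"] afact_prod_rev[of "n - 1"] show thesis
      by simp
  next
    case (3 m)
    then have "\<exists>m\<ge>1. n = 3 * m - 1" "n \<ge> 2"
      by auto
    with that(3)[of "fact (n + 1)"] afact_eqs(4)[of n] show thesis
      by (simp only: afact_prod_rev fact_gt_zero)
  next
    case (4 m)
    then have "\<exists>m\<ge>1. n = 3 * m + 1" "n \<ge> 2"
      by auto
    with that(3)[of 1] afact_eqs(5)[of n] show thesis
      by (simp only: afact_prod_rev mult_1_right zero_less_one)
  qed
qed

lemma afact_pos: "afact n > 0"
proof (induction n rule: less_induct)
  case (less n)
  show ?case
    by (rule afact_cases[of n]) (use less in \<open>auto intro!: prod_pos\<close>)
qed

lemma fact_dvd_afact: "fact n dvd afact n"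
proof (rule afact_cases[of n])
  assume "n \<le> 1" "afact n = 1"
  then show ?thesis
    by (cases n) auto
qed simp_all

lemma afact_mult_dvd:
  assumes "k \<le> n"
  shows "afact k * afact (n - k) dvd afact n"
proof (cases "k = 0 \<or> k = n")
  case True
  then show ?thesis
    using afact_eqs(1) by auto
next
  case False
  show ?thesis
  proof (rule afact_cases[of n])
    assume "n \<le> 1"
    with False assms show ?thesis
      by auto
  next
    assume n: "afact n = fact (n - 1) * fact n * (\<Prod>i = 1..n - 2. afact i)\<^sup>2"
      "afact n = afact (n - 1)"
    show ?thesis
    proof (cases "k = 1 \<or> n - k = 1")
      case True
      \<comment> \<open>The other index is then \<open>n - 1\<close>, out of reach of the product,
        but \<open>afact 1 = 1\<close> and \<open>afact n = afact (n - 1)\<close> turn the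
        divisibility into an equality.\<close>
      with assms have "k = 1 \<or> k = n - 1 \<and> n - k = 1"
        by auto
      then show ?thesis
        using n(2) afact_eqs(2) by auto
    next
      case False
      with \<open>\<not> (k = 0 \<or> k = n)\<close> assms
      have "k \<in> {1..n - 2}" "n - k \<in> {1..n - 2}"
        by auto
      then show ?thesis
        unfolding n(1) by (intro dvd_mult mult_dvd_prod_power2) auto
    qed
  next
    fix c
    assume n: "afact n = fact n * c * (\<Prod>i = 1..n - 1. afact i)\<^sup>2"
    from False assms have "k \<in> {1..n - 1}" "n - k \<in> {1..n - 1}"
      by auto
    then show ?thesis
      unfolding n by (intro dvd_mult mult_dvd_prod_power2) auto
  qed
qed

lemma abstract_factorial_afact: "abstract_factorial afact"
proof -
  have "gen_binomial afact n k \<in> \<int>" if le: "k \<le> n" for n k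
  proof -
    obtain c where "afact n = afact k * afact (n - k) * c"
      using afact_mult_dvd[OF le] by (elim dvdE)
    then have "gen_binomial afact n k = real c"
      using afact_pos[of k] afact_pos[of "n - k"] by (simp add: gen_binomial_def)
    then show ?thesis
      by simp
  qed
  moreover have "gen_binomial afact n k > 0" for n k
    by (simp add: gen_binomial_def afact_pos)
  ultimately show ?thesis
    by (simp add: abstract_factorial_def afact_pos afact_eqs(1) fact_dvd_afact)
qed

theorem proposition12: "exceptional afact"
proof -
  let ?u = "\<lambda>k. ereal (1 / factorial_ratio afact k)"
  have "?u k \<le> 1" for k
  proof -
    \<comment> \<open>Monotonicity is the divisibility result for the split of \<open>k + 1\<close>
      into 1 and \<open>k\<close>.\<close>
    have "afact k \<le> afact (k + 1)"
      using afact_mult_dvd[of 1 "k + 1"] afact_eqs(2) afact_pos by (auto intro: dvd_imp_le)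
    then show ?thesis
      using afact_pos[of "k + 1"] by (simp add: factorial_ratio_def)
  qed
  then have "limsup ?u \<le> 1"
    by (intro Limsup_bounded) simp
  moreover have "1 \<le> limsup ?u"
  proof -
    \<comment> \<open>Since \<open>3 * m + 2 = 3 * (m + 1) - 1\<close>, the next value repeats; this
      constant subsequence bounds the upper limit from below.\<close>
    have "?u (3 * m + 2) = 1" for m
    proof -
      have "\<exists>l\<ge>1. 3 * m + 2 = 3 * l - 1"
        by presburger
      then show ?thesis
        using afact_eqs(3)[of "3 * m + 2"] afact_pos[of "3 * m + 2"]
        by (simp add: factorial_ratio_def)
    qed
    then have "limsup (?u \<circ> (\<lambda>m. 3 * m + 2)) = 1"
      by (simp only: o_def Limsup_const[OF sequentially_bot])
    moreover have "limsup (?u \<circ> (\<lambda>m. 3 * m + 2)) \<le> limsup ?u"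
      by (intro limsup_subseq_mono) (simp add: strict_mono_def)
    ultimately show ?thesis
      by simp
  qed
  ultimately show ?thesis
    by (simp add: exceptional_def abstract_factorial_afact)
qed

end
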